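(* Let $k\in\mathbb{N}$ and $n_1,\dots,n_k\in\{2,3,4,\dots\}$. Two $(n_1,\dots,n_k)$-ary trees are equivalent if and only if one can be obtained from the other through a finite sequence of basic subtree substitutions (for any $p,q\in\{n_1,\dots,n_k\}$ with $p\neq q$).
   Context: An $n$-ary caret (caret of type $n$) is a graph with $n+1$ vertices and $n$ edges: one vertex of degree $n$ (the parent) joined to $n$ vertices of degree 1 (the children), ordered from left to right. An $(n_1,\dots,n_k)$-ary tree is a rooted tree formed by joining a finite number (possibly zero, giving a single vertex) of carets, each of type in $\{n_1,\dots,n_k\}$, by identifying child vertices of carets with parent vertices of other carets. Leaves are the vertices with no children, ordered from left to right. Each vertex represents a closed subinterval of $[0,1]$: the root vertex represents $[0,1]$, and if the parent vertex of an $n$-ary caret represents $[a,b]$, its children represent, from left to right, the $n$ consecutive closed subintervals of equal length into which $[a,b]$ is subdivided. The leaf intervals give the subdivision of $[0,1]$ represented by the tree. Two trees are equivalent if they represent the same subdivision of $[0,1]$. Basic subtree substitution: for $p\ne q$ in $\{n_1,\dots,n_k\}$, replace somewhere in the tree a subtree consisting of one $p$-ary caret together with $q$-ary carets attached to each of its $p$ children by the subtree consisting of one $q$-ary caret together with $p$-ary carets attached to each of its $q$ children. Both have $pq$ leaves; whatever hangs from the $i$th leaf of the old subtree is hung from the $i$th leaf of the new one.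
   Formalization: Adds the assumption that the distinct values among n_1,…,n_k are multiplicatively independent; without it the claim fails (for {2,4}, the 4-ary caret and the depth-2 complete binary tree are equivalent but admit no substitution), and it fails for every dependent set. *)

theory Defs
  imports Complex_Main
begin

text \<open>Rooted ordered trees; \<open>Caret ts\<close> is a caret of type \<open>length ts\<close> whose children, from left to
  right, are the roots of the trees \<open>ts\<close>.\<close>

datatype tree = Leaf | Caret "tree list"

text \<open>\<open>trees N\<close> is the set of trees all of whose carets have their type in \<open>N\<close>.\<close>

inductive_set trees :: "nat set \<Rightarrow> tree set" for N :: "nat set" where
  Leaf: "Leaf \<in> trees N"
| Caret: "length ts \<in> N \<Longrightarrow> (\<And>t. t \<in> set ts \<Longrightarrow> t \<in> trees N) \<Longrightarrow> Caret ts \<in> trees N"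

text \<open>\<open>leaf_intervals a b t\<close> is the set of closed intervals represented by the leaves of \<open>t\<close> when its
  root represents \<open>{a..b}\<close>.\<close>

function leaf_intervals :: "real \<Rightarrow> real \<Rightarrow> tree \<Rightarrow> real set set" where
  "leaf_intervals a b Leaf = {{a..b}}"
| "leaf_intervals a b (Caret ts) =
     (\<Union>i<length ts. leaf_intervals (a + real i * (b - a) / real (length ts))
                                    (a + real (Suc i) * (b - a) / real (length ts)) (ts ! i))"
  by pat_completeness auto
termination
proof (relation "measure (\<lambda>(a, b, t). size t)", goal_cases)
  case 1
  show ?case by simp
next
  case (2 a b ts i)
  then have "ts ! i \<in> set ts" by simp
  then have "size (ts ! i) < Suc (size_list size ts)"
    using size_list_estimation'[of "ts ! i" ts "size (ts ! i)" size] by simp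
  then show ?case by simp
qed

definition subdivision :: "tree \<Rightarrow> real set set" where
  "subdivision t = leaf_intervals 0 1 t"

definition equivalent :: "tree \<Rightarrow> tree \<Rightarrow> bool" where
  "equivalent t u \<longleftrightarrow> subdivision t = subdivision u"

text \<open>In rule \<open>root\<close>, \<open>Caret (map Caret tss)\<close> is a \<open>p\<close>-ary caret with a \<open>q\<close>-ary caret attached to each
  child, and \<open>concat tss\<close> lists the subtrees hanging from the \<open>p * q\<close> leaves of this configuration,
  from left to right. So \<open>concat tss = concat uss\<close> says that what hangs from the \<open>i\<close>th leaf is kept.\<close>

inductive basic_subst :: "nat set \<Rightarrow> tree \<Rightarrow> tree \<Rightarrow> bool" for N :: "nat set" where
  root: "p \<in> N \<Longrightarrow> q \<in> N \<Longrightarrow> p \<noteq> q \<Longrightarrow>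
    length tss = p \<Longrightarrow> \<forall>ts\<in>set tss. length ts = q \<Longrightarrow>
    length uss = q \<Longrightarrow> \<forall>us\<in>set uss. length us = p \<Longrightarrow>
    concat tss = concat uss \<Longrightarrow>
    basic_subst N (Caret (map Caret tss)) (Caret (map Caret uss))"
| inside: "basic_subst N t u \<Longrightarrow> basic_subst N (Caret (xs @ t # ys)) (Caret (xs @ u # ys))"

text \<open>The elements of \<open>N\<close> form a basis of the multiplicative group they generate. Some such
  condition is indispensable: for \<open>N = {2, 4}\<close> the \<open>4\<close>-ary caret and the tree of three binary
  carets with four leaves at depth two represent the same subdivision, but no basic subtree
  substitution applies to either of them.\<close>

definition mult_independent :: "nat set \<Rightarrow> bool" where
  "mult_independent N \<longleftrightarrow>
     (\<forall>a b :: nat \<Rightarrow> nat. (\<Prod>p\<in>N. p ^ a p) = (\<Prod>p\<in>N. p ^ b p) \<longrightarrow> (\<forall>p\<in>N. a p = b p))"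

end

theory Submission
  imports Defs
begin

text \<open>By multiplicative independence, the length of a leaf interval determines how many carets of
  each type lie above that leaf. Hence if \<open>T\<close> is equivalent to a tree whose root caret has type
  \<open>q\<close>, every path from the root of \<open>T\<close> to a leaf meets a \<open>q\<close>-ary caret, and basic subtree
  substitutions move these carets up until the root caret itself has type \<open>q\<close>. Now the subtrees at
  the children of the two roots are equivalent in pairs, and one proceeds by induction.\<close>

section \<open>Leaf intervals\<close>

definition cut_point :: "real \<Rightarrow> real \<Rightarrow> nat \<Rightarrow> nat \<Rightarrow> real" where
  "cut_point a b m i = a + real i * (b - a) / real m"

lemma leaf_intervals_Caret:
  "leaf_intervals a b (Caret ts) =
    (\<Union>i<length ts. leaf_intervals (cut_point a b (length ts) i) (cut_point a b (length ts) (Suc i)) (ts ! i))"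
  by (simp add: cut_point_def)

declare leaf_intervals.simps(2) [simp del]

lemma cut_point_0 [simp]: "cut_point a b m 0 = a"
  by (simp add: cut_point_def)

lemma cut_point_self [simp]: "m > 0 \<Longrightarrow> cut_point a b m m = b"
  by (simp add: cut_point_def)

lemma cut_point_Suc_diff: "cut_point a b m (Suc i) - cut_point a b m i = (b - a) / real m"
  by (simp add: cut_point_def field_simps add_divide_distrib diff_divide_distrib)

lemma cut_point_mono: "a \<le> b \<Longrightarrow> i \<le> j \<Longrightarrow> cut_point a b m i \<le> cut_point a b m j"
  by (simp add: cut_point_def divide_right_mono mult_right_mono)

lemma cut_point_less_Suc: "a < b \<Longrightarrow> m > 0 \<Longrightarrow> cut_point a b m i < cut_point a b m (Suc i)"
  using cut_point_Suc_diff[of a b m i] by (smt (verit) divide_pos_pos of_nat_0_less_iff)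

text \<open>Both ways of cutting have step length \<open>(b - a) / (p * q)\<close>. Its symmetry in
  \<open>p\<close> and \<open>q\<close> is the geometric source of basic subtree
  substitutions.\<close>

lemma cut_point_cut_point:
  assumes "i < p" "j \<le> q" "q > 0"
  shows "cut_point (cut_point a b p i) (cut_point a b p (Suc i)) q j = cut_point a b (p * q) (i * q + j)"
proof -
  have "cut_point (cut_point a b p i) (cut_point a b p (Suc i)) q j = cut_point a b p i + real j * ((b - a) / real p) / real q"
    by (simp add: cut_point_def[of "cut_point a b p i"] cut_point_Suc_diff)
  also have "\<dots> = cut_point a b (p * q) (i * q + j)"
    using assms by (simp add: cut_point_def field_simps)
  finally show ?thesis .
qed

text \<open>The strict \<open>c < d\<close> carries later arguments: a nondegenerate interval fits
  into only one piece of a cut and determines its endpoints.\<close>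

lemma leaf_interval_bounds:
  assumes "t \<in> trees N" "I \<in> leaf_intervals a b t" "a < b"
  obtains c d where "I = {c..d}" "a \<le> c" "c < d" "d \<le> b"
  using assms
proof (induction arbitrary: a b thesis rule: trees.induct)
  case Leaf
  then show ?case by auto
next
  case (Caret ts)
  let ?m = "length ts"
  from Caret.prems(2) obtain i where i: "i < ?m"
    "I \<in> leaf_intervals (cut_point a b ?m i) (cut_point a b ?m (Suc i)) (ts ! i)"
    by (auto simp: leaf_intervals_Caret)
  have "ts ! i \<in> set ts" "cut_point a b ?m i < cut_point a b ?m (Suc i)"
    using i(1) Caret.prems(3) by (auto intro!: cut_point_less_Suc)
  then obtain c d where cd: "I = {c..d}" "cut_point a b ?m i \<le> c" "c < d" "d \<le> cut_point a b ?m (Suc i)"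
    using Caret.IH i(2) by metis
  have "cut_point a b ?m ?m = b"
    using i(1) by (intro cut_point_self) linarith
  then have "a \<le> cut_point a b ?m i" "cut_point a b ?m (Suc i) \<le> b"
    using cut_point_mono[of a b 0 i ?m] cut_point_mono[of a b "Suc i" ?m ?m] i(1) Caret.prems(3)
    by auto
  with cd show ?case by (intro Caret.prems(1)[of c d]) auto
qed

text \<open>Distinct pieces share at most an endpoint, so no leaf interval of one lies inside
  another. This lets equivalence of trees with equal root types pass to their children.\<close>

lemma leaf_intervals_child:
  assumes "Caret ts \<in> trees N" "i < length ts" "a < b"
  shows "leaf_intervals (cut_point a b (length ts) i) (cut_point a b (length ts) (Suc i)) (ts ! i) =
    {I \<in> leaf_intervals a b (Caret ts). I \<subseteq> {cut_point a b (length ts) i..cut_point a b (length ts) (Suc i)}}"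
    (is "?L i = ?R")
proof
  let ?c = "cut_point a b (length ts)"
  have child: "ts ! j \<in> trees N" if "j < length ts" for j
    using assms(1) that by (auto elim: trees.cases)
  have less: "?c j < ?c (Suc j)" for j
    using assms by (auto intro!: cut_point_less_Suc)
  show "?L i \<subseteq> ?R"
  proof
    fix I assume I: "I \<in> ?L i"
    then obtain c d where "I = {c..d}" "?c i \<le> c" "d \<le> ?c (Suc i)"
      using leaf_interval_bounds[OF child[OF assms(2)] I less] by metis
    with I assms(2) show "I \<in> ?R" by (auto simp: leaf_intervals_Caret)
  qed
  show "?R \<subseteq> ?L i"
  proof
    fix I assume I: "I \<in> ?R"
    then obtain j where j: "j < length ts" "I \<in> ?L j"
      by (auto simp: leaf_intervals_Caret)
    obtain c d where cd: "I = {c..d}" "?c j \<le> c" "c < d" "d \<le> ?c (Suc j)"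
      using leaf_interval_bounds[OF child[OF j(1)] j(2) less] by metis
    have ci: "?c i \<le> c" "d \<le> ?c (Suc i)"
      using I cd by auto
    \<comment> \<open>Otherwise a cut point separates the pieces \<open>i\<close> and
      \<open>j\<close>, which forces \<open>d\<close> \<le> \<open>c\<close>.\<close>
    have "\<not> Suc i \<le> j" "\<not> Suc j \<le> i"
      using cut_point_mono[of a b "Suc i" j "length ts"] cut_point_mono[of a b "Suc j" i "length ts"] ci cd assms(3)
      by (meson less_imp_le not_le order_less_le_trans order_le_less_trans)+
    then have "i = j" by simp
    with j show "I \<in> ?L i" by simp
  qed
qed

section \<open>Substitutions preserve the subdivision\<close>

lemma nth_concat_uniform:
  assumes "\<forall>xs\<in>set xss. length xs = q" "i < length xss" "j < q"
  shows "concat xss ! (i * q + j) = xss ! i ! j"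
  using assms
proof (induction xss arbitrary: i)
  case (Cons xs xss)
  then show ?case by (cases i) (auto simp: nth_append)
qed simp

lemma length_concat_uniform:
  "\<forall>xs\<in>set xss. length xs = q \<Longrightarrow> length (concat xss) = length xss * q"
  by (induction xss) auto

text \<open>\<open>Caret (concat tss)\<close> serves as a common flat form. Its type need not be an
  admissible one, but both sides of a root substitution flatten to the same tree.\<close>

lemma leaf_intervals_two_level:
  assumes "\<forall>ts\<in>set tss. length ts = q"
  shows "leaf_intervals a b (Caret (map Caret tss)) = leaf_intervals a b (Caret (concat tss))"
proof -
  let ?p = "length tss"
  define F where "F k = leaf_intervals (cut_point a b (?p * q) k) (cut_point a b (?p * q) (Suc k)) (concat tss ! k)" for k
  have inner: "leaf_intervals (cut_point a b ?p i) (cut_point a b ?p (Suc i)) (Caret (tss ! i)) = (\<Union>j<q. F (i * q + j))"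
    if i: "i < ?p" for i
  proof -
    have "length (tss ! i) = q" using assms i by simp
    then show ?thesis
      using i by (auto simp: leaf_intervals_Caret F_def cut_point_cut_point nth_concat_uniform[OF assms]
          simp flip: add_Suc_right)
  qed
  have index: "(\<Union>i<?p. \<Union>j<q. F (i * q + j)) = (\<Union>k<?p * q. F k)"
  proof (intro equalityI subsetI)
    fix x assume "x \<in> (\<Union>i<?p. \<Union>j<q. F (i * q + j))"
    then obtain i j where ij: "i < ?p" "j < q" "x \<in> F (i * q + j)" by auto
    have "i * q + j < Suc i * q" using ij by simp
    also have "\<dots> \<le> ?p * q" using ij by (intro mult_le_mono1) simp
    finally show "x \<in> (\<Union>k<?p * q. F k)" using ij by auto
  next
    fix x assume "x \<in> (\<Union>k<?p * q. F k)"
    then obtain k where k: "k < ?p * q" "x \<in> F k" by auto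
    then have "q > 0" by (cases q) auto
    then have "k div q < ?p" "k mod q < q" "x \<in> F (k div q * q + k mod q)"
      using k by (auto simp: less_mult_imp_div_less)
    then show "x \<in> (\<Union>i<?p. \<Union>j<q. F (i * q + j))" by blast
  qed
  have "leaf_intervals a b (Caret (map Caret tss)) = (\<Union>i<?p. \<Union>j<q. F (i * q + j))"
    by (simp add: leaf_intervals_Caret[of _ _ "map Caret tss"] inner)
  then show ?thesis
    by (simp only: index) (simp add: leaf_intervals_Caret length_concat_uniform[OF assms] F_def)
qed

lemma basic_subst_leaf_intervals:
  "basic_subst N t u \<Longrightarrow> leaf_intervals a b t = leaf_intervals a b u"
proof (induction arbitrary: a b rule: basic_subst.induct)
  case (root p q tss uss)
  then show ?case
    by (simp only: leaf_intervals_two_level)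
next
  case (inside t u xs ys)
  then show ?case
    by (auto simp: leaf_intervals_Caret nth_append nth_Cons' intro!: SUP_cong)
qed

section \<open>Moving a caret type to the root\<close>

text \<open>\<open>xs\<close> holds the left siblings that have been rewritten already, so the
  induction can move on one child at a time.\<close>

lemma basic_substs_Caret:
  assumes "list_all2 (basic_subst N)\<^sup>*\<^sup>* ts us"
  shows "(basic_subst N)\<^sup>*\<^sup>* (Caret (xs @ ts)) (Caret (xs @ us))"
  using assms
proof (induction arbitrary: xs rule: list_all2_induct)
  case (Cons t ts u us)
  have "(basic_subst N)\<^sup>*\<^sup>* (Caret (xs @ t # ts)) (Caret (xs @ u # ts))"
    using Cons.hyps(1) by induction (auto intro: rtranclp.rtrancl_into_rtrancl basic_subst.inside)
  with Cons.IH[of "xs @ [u]"] show ?case by simp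
qed simp

lemma split_uniform:
  "length xs = m * n \<Longrightarrow> \<exists>xss. length xss = m \<and> (\<forall>ys\<in>set xss. length ys = n) \<and> concat xss = xs"
proof (induction m arbitrary: xs)
  case (Suc m)
  then obtain xss where "length xss = m" "\<forall>ys\<in>set xss. length ys = n" "concat xss = drop n xs"
    by (metis add_diff_cancel_left' length_drop mult_Suc)
  with Suc.prems show ?case
    by (intro exI[of _ "take n xs # xss"]) auto
qed simp

text \<open>No rule covers \<open>Leaf\<close>, so a path that ends without a \<open>q\<close>-ary
  caret refutes the predicate. The rules overlap: \<open>below\<close> also admits a
  \<open>q\<close>-ary root.\<close>

inductive on_every_path :: "nat \<Rightarrow> tree \<Rightarrow> bool" for q :: nat where
  here: "length ts = q \<Longrightarrow> on_every_path q (Caret ts)"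
| below: "(\<And>t. t \<in> set ts \<Longrightarrow> on_every_path q t) \<Longrightarrow> on_every_path q (Caret ts)"

text \<open>By induction each child can be given a \<open>q\<close>-ary root caret; one substitution
  at the root then exchanges the two levels.\<close>

lemma on_every_path_to_root:
  assumes "on_every_path q t" "t \<in> trees N" "q \<in> N"
  shows "\<exists>ts. length ts = q \<and> Caret ts \<in> trees N \<and> (basic_subst N)\<^sup>*\<^sup>* t (Caret ts)"
  using assms
proof (induction rule: on_every_path.induct)
  case (here ts)
  then show ?case by blast
next
  case (below ts)
  from below.prems(1) have ts: "length ts \<in> N" "\<And>t. t \<in> set ts \<Longrightarrow> t \<in> trees N"
    by (auto elim: trees.cases)
  \<comment> \<open>A substitution exchanges distinct types only, so a root that already has type
    \<open>q\<close> is treated apart.\<close>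
  show ?case
  proof (cases "length ts = q")
    case True
    with below.prems show ?thesis by blast
  next
    case False
    have "\<forall>t\<in>set ts. \<exists>vs. length vs = q \<and> Caret vs \<in> trees N \<and> (basic_subst N)\<^sup>*\<^sup>* t (Caret vs)"
      using below.IH ts(2) below.prems(2) by blast
    then obtain f where f: "\<And>t. t \<in> set ts \<Longrightarrow> length (f t) = q"
      "\<And>t. t \<in> set ts \<Longrightarrow> Caret (f t) \<in> trees N"
      "\<And>t. t \<in> set ts \<Longrightarrow> (basic_subst N)\<^sup>*\<^sup>* t (Caret (f t))"
      by metis
    define tss where "tss = map f ts"
    have tss: "length tss = length ts" "\<forall>vs\<in>set tss. length vs = q"
      using f(1) by (auto simp: tss_def)
    have "length (concat tss) = q * length ts"
      using length_concat_uniform[OF tss(2)] tss(1) by (simp add: mult.commute)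
    \<comment> \<open>The same subtrees, regrouped into \<open>q\<close> blocks of
      \<open>length ts\<close>, form the other side of the substitution.\<close>
    then obtain uss where uss: "length uss = q" "\<forall>us\<in>set uss. length us = length ts"
      "concat uss = concat tss"
      using split_uniform by blast
    have "list_all2 (basic_subst N)\<^sup>*\<^sup>* ts (map Caret tss)"
      using f(3) by (auto simp: tss_def list_all2_conv_all_nth)
    then have "(basic_subst N)\<^sup>*\<^sup>* (Caret ts) (Caret (map Caret tss))"
      using basic_substs_Caret[where xs = "[]"] by simp
    moreover have "basic_subst N (Caret (map Caret tss)) (Caret (map Caret uss))"
      using ts(1) below.prems(2) False tss uss by (intro basic_subst.root) auto
    ultimately have steps: "(basic_subst N)\<^sup>*\<^sup>* (Caret ts) (Caret (map Caret uss))"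
      by (rule rtranclp.rtrancl_into_rtrancl)
    have leaves: "v \<in> trees N" if "v \<in> set (concat uss)" for v
    proof -
      from that obtain t where "t \<in> set ts" "v \<in> set (f t)"
        unfolding uss(3) by (auto simp: tss_def)
      with f(2) show ?thesis by (auto elim: trees.cases)
    qed
    have "Caret us \<in> trees N" if "us \<in> set uss" for us
      using that ts(1) uss(2) leaves by (intro trees.Caret) auto
    then have "Caret (map Caret uss) \<in> trees N"
      using uss(1) below.prems(2) by (intro trees.Caret) auto
    with steps uss(1) show ?thesis by (intro exI[of _ "map Caret uss"]) simp
  qed
qed

section \<open>Lengths of leaf intervals\<close>

text \<open>With \<open>e p\<close> the number of \<open>p\<close>-ary carets above a leaf, this is
  the ratio of the root interval's length to that of the leaf interval.\<close>

definition monomial :: "nat set \<Rightarrow> (nat \<Rightarrow> nat) \<Rightarrow> nat" where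
  "monomial N e = (\<Prod>p\<in>N. p ^ e p)"

lemma monomial_upd:
  assumes "finite N" "p \<in> N"
  shows "monomial N (e(p := Suc (e p))) = p * monomial N e"
proof -
  have "(\<Prod>r\<in>N - {p}. r ^ (e(p := Suc (e p))) r) = (\<Prod>r\<in>N - {p}. r ^ e r)"
    by (intro prod.cong) auto
  then show ?thesis
    using assms by (simp add: monomial_def prod.remove[of N p])
qed

text \<open>The common step of the length lemmas below: passing an \<open>m\<close>-ary caret raises
  the exponent at \<open>m\<close> by one.\<close>

lemma child_length:
  assumes "finite N" "m \<in> N" "m > 0"
    and "cut_point a b m (Suc i) - cut_point a b m i = (d - c) * real (monomial N e)"
  shows "b - a = (d - c) * real (monomial N (e(m := Suc (e m))))"
  using assms by (simp add: cut_point_Suc_diff monomial_upd field_simps)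

lemma leaf_length:
  assumes "t \<in> trees N" "finite N" "0 \<notin> N" "I \<in> leaf_intervals a b t"
  shows "\<exists>c d e. I = {c..d} \<and> b - a = (d - c) * real (monomial N e)"
  using assms
proof (induction arbitrary: a b rule: trees.induct)
  case Leaf
  \<comment> \<open>No caret lies above the leaf, so all exponents are zero and the ratio is
    1.\<close>
  then show ?case
    by (intro exI[of _ a] exI[of _ b] exI[of _ "\<lambda>_. 0"]) (simp add: monomial_def)
next
  case (Caret ts)
  let ?m = "length ts"
  from Caret.prems(3) obtain i where i: "i < ?m"
    "I \<in> leaf_intervals (cut_point a b ?m i) (cut_point a b ?m (Suc i)) (ts ! i)"
    by (auto simp: leaf_intervals_Caret)
  then obtain c d e where "I = {c..d}"
    "cut_point a b ?m (Suc i) - cut_point a b ?m i = (d - c) * real (monomial N e)"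
    using Caret.IH[of "ts ! i"] Caret.prems by (meson nth_mem)
  moreover from this i(1) have
    "b - a = (d - c) * real (monomial N (e(?m := Suc (e ?m))))"
    using child_length[OF Caret.prems(1) Caret.hyps(1)] by (metis gr_implies_not_zero neq0_conv)
  ultimately show ?case by blast
qed

text \<open>The root caret lies above every leaf, so its type is counted at least once for each of
  them.\<close>

lemma leaf_length_Caret:
  assumes "Caret ts \<in> trees N" "finite N" "0 \<notin> N" "I \<in> leaf_intervals a b (Caret ts)"
  shows "\<exists>c d e. I = {c..d} \<and> b - a = (d - c) * real (monomial N e) \<and> e (length ts) > 0"
proof -
  let ?m = "length ts"
  from assms(1) have ts: "?m \<in> N" "\<And>t. t \<in> set ts \<Longrightarrow> t \<in> trees N"
    by (auto elim: trees.cases)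
  from assms(4) obtain i where i: "i < ?m"
    "I \<in> leaf_intervals (cut_point a b ?m i) (cut_point a b ?m (Suc i)) (ts ! i)"
    by (auto simp: leaf_intervals_Caret)
  then obtain c d e where e: "I = {c..d}"
    "cut_point a b ?m (Suc i) - cut_point a b ?m i = (d - c) * real (monomial N e)"
    using leaf_length[OF ts(2) assms(2,3)] by (meson nth_mem)
  have "b - a = (d - c) * real (monomial N (e(?m := Suc (e ?m))))"
    using child_length[OF assms(2) ts(1) _ e(2)] i(1) by linarith
  with e(1) show ?thesis
    by (intro exI[of _ c] exI[of _ d] exI[of _ "e(?m := Suc (e ?m))"]) simp
qed

text \<open>Descending each time into a child that still fails \<open>on_every_path q\<close> ends
  at a leaf with no \<open>q\<close>-ary caret above it.\<close>

lemma leaf_length_avoiding: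
  assumes "t \<in> trees N" "finite N" "0 \<notin> N" "\<not> on_every_path q t"
  shows "\<exists>c d e. {c..d} \<in> leaf_intervals a b t \<and> b - a = (d - c) * real (monomial N e) \<and> e q = 0"
  using assms
proof (induction arbitrary: a b rule: trees.induct)
  case Leaf
  then show ?case
    by (intro exI[of _ a] exI[of _ b] exI[of _ "\<lambda>_. 0"]) (simp add: monomial_def)
next
  case (Caret ts)
  let ?m = "length ts"
  from Caret.prems(3) have q: "?m \<noteq> q"
    by (auto intro: on_every_path.here)
  from Caret.prems(3) obtain t where "t \<in> set ts" "\<not> on_every_path q t"
    by (auto intro: on_every_path.below)
  then obtain i where i: "i < ?m" "\<not> on_every_path q (ts ! i)"
    by (auto simp: in_set_conv_nth)
  then obtain c d e where e:
    "{c..d} \<in> leaf_intervals (cut_point a b ?m i) (cut_point a b ?m (Suc i)) (ts ! i)"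
    "cut_point a b ?m (Suc i) - cut_point a b ?m i = (d - c) * real (monomial N e)" "e q = 0"
    using Caret.IH[of "ts ! i"] Caret.prems by (meson nth_mem)
  have "b - a = (d - c) * real (monomial N (e(?m := Suc (e ?m))))"
    using child_length[OF Caret.prems(1) Caret.hyps(1) _ e(2)] i(1) by linarith
  moreover have "{c..d} \<in> leaf_intervals a b (Caret ts)"
    unfolding leaf_intervals_Caret using e(1) i(1) by blast
  moreover have "(e(?m := Suc (e ?m))) q = 0"
    using e(3) q by simp
  ultimately show ?case by blast
qed

section \<open>Equivalent trees\<close>

text \<open>A leaf of \<open>t\<close> with no caret of type \<open>length us\<close> above it would
  also be a leaf interval of \<open>Caret us\<close>, where that type is counted. Multiplicative
  independence forbids two different counts for one length.\<close>

lemma on_every_path_of_equal_leaf_intervals: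
  assumes "t \<in> trees N" "Caret us \<in> trees N" "finite N" "0 \<notin> N" "mult_independent N" "a < b"
    and eq: "leaf_intervals a b t = leaf_intervals a b (Caret us)"
  shows "on_every_path (length us) t"
proof (rule ccontr)
  assume "\<not> on_every_path (length us) t"
  then obtain c d e where e: "{c..d} \<in> leaf_intervals a b t"
    "b - a = (d - c) * real (monomial N e)" "e (length us) = 0"
    using leaf_length_avoiding assms by meson
  then obtain c' d' e' where e': "{c..d} = {c'..d'}"
    "b - a = (d' - c') * real (monomial N e')" "e' (length us) > 0"
    using leaf_length_Caret[OF assms(2-4)] eq by metis
  \<comment> \<open>Strictness serves twice: it makes the endpoints readable from the set, and it
    allows \<open>d - c\<close> to be cancelled.\<close>
  have "c < d"
    using leaf_interval_bounds[OF assms(1) e(1) assms(6)]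
    by (metis Icc_eq_Icc less_imp_le not_le)
  moreover from this have "c = c'" "d = d'"
    using e'(1) by (auto simp: Icc_eq_Icc)
  ultimately have "monomial N e = monomial N e'"
    using e(2) e'(2) by simp
  then have "\<forall>p\<in>N. e p = e' p"
    using assms(5) unfolding mult_independent_def monomial_def by blast
  moreover have "length us \<in> N"
    using assms(2) by (auto elim: trees.cases)
  ultimately show False using e(3) e'(3) by auto
qed

text \<open>The induction is on \<open>u\<close>; \<open>t\<close>, \<open>a\<close> and
  \<open>b\<close> vary because the hypothesis is applied to the children of a rewritten
  \<open>t\<close>, each on its own piece.\<close>

lemma equal_leaf_intervals_imp_basic_substs:
  assumes "u \<in> trees N" "t \<in> trees N" "finite N" "\<forall>p\<in>N. p \<ge> 2" "mult_independent N" "a < b"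
    and "leaf_intervals a b t = leaf_intervals a b u"
  shows "(basic_subst N)\<^sup>*\<^sup>* t u"
  using assms
proof (induction arbitrary: t a b rule: trees.induct)
  case Leaf
  show ?case
  proof (cases t)
    \<comment> \<open>A root caret has type at least 2, so every leaf interval of \<open>t\<close>
      would be shorter than \<open>{a..b}\<close>, the only leaf interval of
      \<open>u\<close>.\<close>
    case (Caret ts)
    have ts: "length ts \<in> N" "\<And>t. t \<in> set ts \<Longrightarrow> t \<in> trees N"
      using Leaf.prems(1) unfolding Caret by (auto elim: trees.cases)
    then have len: "length ts \<ge> 2" using Leaf.prems(3) by blast
    then have le: "{a..b} \<subseteq> {cut_point a b (length ts) i..cut_point a b (length ts) (Suc i)}" if "i < length ts"
      "{a..b} \<in> leaf_intervals (cut_point a b (length ts) i) (cut_point a b (length ts) (Suc i)) (ts ! i)" for i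
      using leaf_intervals_child[of ts N i a b] Leaf.prems that unfolding Caret by auto
    have "{a..b} \<in> leaf_intervals a b (Caret ts)"
      using Leaf.prems(6) by (simp add: Caret)
    then obtain i where "i < length ts"
      "{a..b} \<subseteq> {cut_point a b (length ts) i..cut_point a b (length ts) (Suc i)}"
      using le by (auto simp: leaf_intervals_Caret)
    then have "b - a \<le> cut_point a b (length ts) (Suc i) - cut_point a b (length ts) i"
      using Leaf.prems(5) by auto
    also have "\<dots> < b - a"
      using len Leaf.prems(5) by (simp add: cut_point_Suc_diff divide_less_eq)
    finally show ?thesis by simp
  qed simp
next
  case (Caret us)
  let ?q = "length us"
  have zero: "0 \<notin> N" using Caret.prems(3) by force
  have u: "Caret us \<in> trees N"
    using Caret.hyps by (rule trees.Caret)
  have "on_every_path ?q t"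
    using on_every_path_of_equal_leaf_intervals[OF Caret.prems(1) u Caret.prems(2) zero
        Caret.prems(4-6)] .
  then obtain ts where ts: "length ts = ?q" "Caret ts \<in> trees N" "(basic_subst N)\<^sup>*\<^sup>* t (Caret ts)"
    using on_every_path_to_root Caret.prems(1) Caret.hyps(1) by blast
  \<comment> \<open>The rewriting kept the subdivision, so two trees of equal root type remain to be
    compared child by child.\<close>
  have "leaf_intervals a b t = leaf_intervals a b (Caret ts)"
    using ts(3) by induction (auto dest: basic_subst_leaf_intervals)
  with Caret.prems(6) have eq: "leaf_intervals a b (Caret ts) = leaf_intervals a b (Caret us)"
    by simp
  have "(basic_subst N)\<^sup>*\<^sup>* (ts ! i) (us ! i)" if i: "i < ?q" for i
  proof (rule Caret.IH)
    show "us ! i \<in> set us" using i by simp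
    show "ts ! i \<in> trees N"
      using ts(1,2) i by (auto elim: trees.cases)
    show "cut_point a b ?q i < cut_point a b ?q (Suc i)"
      using i Caret.prems(5) by (auto intro!: cut_point_less_Suc)
    show "leaf_intervals (cut_point a b ?q i) (cut_point a b ?q (Suc i)) (ts ! i) =
        leaf_intervals (cut_point a b ?q i) (cut_point a b ?q (Suc i)) (us ! i)"
      using leaf_intervals_child[OF ts(2), of i a b] leaf_intervals_child[OF u, of i a b]
        ts(1) i Caret.prems(5) eq by simp
  qed (use Caret.prems in auto)
  then have "list_all2 (basic_subst N)\<^sup>*\<^sup>* ts us"
    using ts(1) by (simp add: list_all2_conv_all_nth)
  then have "(basic_subst N)\<^sup>*\<^sup>* (Caret ts) (Caret us)"
    using basic_substs_Caret[where xs = "[]"] by simp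
  with ts(3) show ?case by simp
qed

theorem theorem2p4:
  fixes k :: nat and n :: "nat \<Rightarrow> nat" and T U :: tree
  assumes "\<forall>i\<in>{1..k}. n i \<ge> 2"
    and "mult_independent (n ` {1..k})"
    and "T \<in> trees (n ` {1..k})" and "U \<in> trees (n ` {1..k})"
  shows "equivalent T U \<longleftrightarrow> (basic_subst (n ` {1..k}))\<^sup>*\<^sup>* T U"
proof
  assume "equivalent T U"
  \<comment> \<open>The general result is taken on the root interval [0,1]; the set of types is
    finite as the image of \<open>{1..k}\<close>.\<close>
  then show "(basic_subst (n ` {1..k}))\<^sup>*\<^sup>* T U"
    unfolding equivalent_def subdivision_def using assms
    by (intro equal_leaf_intervals_imp_basic_substs[where a = 0 and b = 1]) auto
next
  assume "(basic_subst (n ` {1..k}))\<^sup>*\<^sup>* T U"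
  then show "equivalent T U"
    unfolding equivalent_def subdivision_def
    by induction (auto dest: basic_subst_leaf_intervals)
qed

end
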